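(* Let $X$ be a finite set of alternatives with $|X|=m\geq 3$ and let $N=\{1,\dots,n\}$ with $n\geq 2$. The range of approval voting $G_A$ is the collection of all non-empty subsets of $X$; that is, for every non-empty $S\subseteq X$ there are a profile $u\in L(X)^N$ and an index vector $b\in\{1,\dots,m\}^N$ with $G_A(u,b)=S$.
   Context: $L(X)$ is the set of strong orderings on $X$: complete (any two distinct alternatives are comparable), asymmetric, transitive relations. A profile is $u=(u(1),\dots,u(n))\in L(X)^N$; $u(i)[1:p]$ is the set of alternatives in the top $p$ ranks of $u(i)$. An index vector is $b=(b_1,\dots,b_n)\in\{1,\dots,m\}^N$. The approval voting score is $A_S(x,u,b)=|\{i\in N: x\in u(i)[1:b_i]\}|$ (the subscript $S$ is part of the name and unrelated to the set $S$). Approval voting is $G_A(u,b)=\{x\in X: A_S(x,u,b)\geq A_S(y,u,b)\text{ for all }y\in X\}$. *)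

theory Defs
  imports Complex_Main "HOL-Library.FuncSet"
begin

text \<open>A pair \<open>(x, y)\<close> in an ordering means that \<open>x\<close> is ranked strictly above \<open>y\<close>.\<close>

definition strong_orderings :: "'a set \<Rightarrow> ('a \<times> 'a) set set" where
  "strong_orderings X = {r. r \<subseteq> X \<times> X \<and> total_on X r \<and> asym r \<and> trans r}"

text \<open>Rank 1 is the best rank: the rank of \<open>x\<close> is one more than the number of alternatives above it.\<close>

definition rank :: "'a set \<Rightarrow> ('a \<times> 'a) set \<Rightarrow> 'a \<Rightarrow> nat" where
  "rank X r x = card {y \<in> X. (y, x) \<in> r} + 1"

definition top_ranks :: "'a set \<Rightarrow> ('a \<times> 'a) set \<Rightarrow> nat \<Rightarrow> 'a set" where
  "top_ranks X r p = {x \<in> X. rank X r x \<le> p}"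

definition profiles :: "'a set \<Rightarrow> nat set \<Rightarrow> (nat \<Rightarrow> ('a \<times> 'a) set) set" where
  "profiles X N = N \<rightarrow>\<^sub>E strong_orderings X"

definition index_vectors :: "'a set \<Rightarrow> nat set \<Rightarrow> (nat \<Rightarrow> nat) set" where
  "index_vectors X N = N \<rightarrow>\<^sub>E {1..card X}"

definition approval_score ::
  "'a set \<Rightarrow> nat set \<Rightarrow> 'a \<Rightarrow> (nat \<Rightarrow> ('a \<times> 'a) set) \<Rightarrow> (nat \<Rightarrow> nat) \<Rightarrow> nat" where
  "approval_score X N x u b = card {i \<in> N. x \<in> top_ranks X (u i) (b i)}"

definition approval_voting ::
  "'a set \<Rightarrow> nat set \<Rightarrow> (nat \<Rightarrow> ('a \<times> 'a) set) \<Rightarrow> (nat \<Rightarrow> nat) \<Rightarrow> 'a set" where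
  "approval_voting X N u b =
     {x \<in> X. \<forall>y\<in>X. approval_score X N x u b \<ge> approval_score X N y u b}"

end

theory Submission
  imports Defs
begin

text \<open>
  Approval voting only sees the sets of approved alternatives. An approval set \<open>S\<close> can be any
  non-empty set, because some strong ordering ranks \<open>S\<close> above everything else and the cut-off
  may be placed at \<open>card S\<close>. If all voters approve exactly \<open>S\<close>, then the members of \<open>S\<close> score the
  number of voters and all others score zero, so \<open>S\<close> is the set of winners. Conversely a maximal
  score is attained on a finite non-empty set of alternatives, so there is always a winner.
\<close>

text \<open>
  Any numbering of the finite set orders it strongly; comparing membership in \<open>S\<close> first and the
  number second lifts \<open>S\<close> to the top. A member of \<open>S\<close> then has only other members of \<open>S\<close> above it,
  and a non-member has all of \<open>S\<close> above it, which places the cut exactly at rank \<open>card S\<close>.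
\<close>
lemma strong_ordering_with_top_set:
  assumes "finite X" and "S \<subseteq> X"
  obtains r where "r \<in> strong_orderings X" and "top_ranks X r (card S) = S"
proof -
  obtain g :: "'a \<Rightarrow> nat" where g: "inj_on g X"
    using finite_imp_inj_to_nat_seg[OF \<open>finite X\<close>] by blast
  define r where "r = {(x, y). x \<in> X \<and> y \<in> X \<and>
      (x \<in> S \<and> y \<notin> S \<or> (x \<in> S \<longleftrightarrow> y \<in> S) \<and> g x < g y)}"
  have "total_on X r"
  proof (rule total_onI)
    fix x y
    assume xy: "x \<in> X" "y \<in> X" "x \<noteq> y"
    then have "g x < g y \<or> g y < g x"
      using g by (meson inj_onD nat_neq_iff)
    then show "(x, y) \<in> r \<or> (y, x) \<in> r"
      using xy by (auto simp: r_def)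
  qed
  moreover have "asym r"
    by (rule asymI) (auto simp: r_def)
  moreover have "trans r"
    by (rule transI) (auto simp: r_def)
  ultimately have order: "r \<in> strong_orderings X"
    by (auto simp: strong_orderings_def r_def)
  have "finite S"
    using assms finite_subset by blast
  have inside: "rank X r x \<le> card S" if "x \<in> S" for x
  proof -
    have "{y \<in> X. (y, x) \<in> r} \<subset> S"
      using that by (auto simp: r_def)
    then have "card {y \<in> X. (y, x) \<in> r} < card S"
      by (rule psubset_card_mono[OF \<open>finite S\<close>])
    then show ?thesis
      by (simp add: rank_def)
  qed
  have outside: "card S < rank X r x" if "x \<in> X - S" for x
  proof -
    have "S \<subseteq> {y \<in> X. (y, x) \<in> r}"
      using that assms(2) by (auto simp: r_def)
    then show ?thesis
      using card_mono[of "{y \<in> X. (y, x) \<in> r}" S] assms(1) by (simp add: rank_def)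
  qed
  have "top_ranks X r (card S) = S"
  proof (intro equalityI subsetI)
    fix x
    assume "x \<in> top_ranks X r (card S)"
    then show "x \<in> S"
      using outside[of x] by (cases "x \<in> S") (simp_all add: top_ranks_def)
  next
    fix x
    assume "x \<in> S"
    then show "x \<in> top_ranks X r (card S)"
      using inside[of x] assms(2) by (simp add: top_ranks_def subsetD)
  qed
  with order show thesis
    by (rule that)
qed

lemma approval_voting_nonempty:
  assumes "finite X" and "X \<noteq> {}"
  shows "approval_voting X N u b \<noteq> {}"
proof -
  let ?score = "\<lambda>x. approval_score X N x u b"
  have "Max (?score ` X) \<in> ?score ` X"
    using assms by (intro Max_in) auto
  then obtain x where "x \<in> X" "?score x = Max (?score ` X)"
    by auto
  then have "x \<in> approval_voting X N u b"
    using assms(1) by (simp add: approval_voting_def)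
  then show ?thesis
    by blast
qed

lemma approval_voting_unanimous:
  assumes "finite N" and "N \<noteq> {}" and "S \<subseteq> X" and "S \<noteq> {}"
    and "\<And>i. i \<in> N \<Longrightarrow> top_ranks X (u i) (b i) = S"
  shows "approval_voting X N u b = S"
proof -
  have "approval_score X N x u b = (if x \<in> S then card N else 0)" for x
  proof -
    have "{i \<in> N. x \<in> top_ranks X (u i) (b i)} = (if x \<in> S then N else {})"
      using assms(5) by auto
    then show ?thesis
      by (simp add: approval_score_def)
  qed
  moreover have "0 < card N"
    using assms(1,2) by (simp add: card_gt_0_iff)
  ultimately show ?thesis
    using assms(3,4) by (auto simp: approval_voting_def)
qed

theorem mainTheorem7:
  fixes X :: "'a set" and N :: "nat set" and n :: nat
  assumes "finite X" and "card X \<ge> 3"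
    and "N = {1..n}" and "n \<ge> 2"
  shows "{approval_voting X N u b | u b. u \<in> profiles X N \<and> b \<in> index_vectors X N}
           = {S. S \<subseteq> X \<and> S \<noteq> {}}"
proof (intro equalityI subsetI)
  fix S
  assume "S \<in> {approval_voting X N u b | u b. u \<in> profiles X N \<and> b \<in> index_vectors X N}"
  then obtain u b where S: "S = approval_voting X N u b"
    by blast
  have "X \<noteq> {}"
    using assms(2) by auto
  then have "S \<noteq> {}"
    unfolding S using assms(1) by (intro approval_voting_nonempty)
  moreover have "S \<subseteq> X"
    unfolding S by (auto simp: approval_voting_def)
  ultimately show "S \<in> {S. S \<subseteq> X \<and> S \<noteq> {}}"
    by simp
next
  fix S
  assume "S \<in> {S. S \<subseteq> X \<and> S \<noteq> {}}"
  then have S: "S \<subseteq> X" "S \<noteq> {}"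
    by auto
  obtain r where r: "r \<in> strong_orderings X" "top_ranks X r (card S) = S"
    using strong_ordering_with_top_set[OF assms(1) S(1)] .
  define u where "u = restrict (\<lambda>_. r) N"
  define b where "b = restrict (\<lambda>_. card S) N"
  have "card S \<in> {1..card X}"
    using S assms(1) card_mono[of X S] finite_subset[of S X]
    by (auto simp: Suc_le_eq card_gt_0_iff)
  then have "u \<in> profiles X N" "b \<in> index_vectors X N"
    using r(1) by (auto simp: u_def b_def profiles_def index_vectors_def)
  moreover have "approval_voting X N u b = S"
    using S r(2) assms(3,4) by (intro approval_voting_unanimous) (auto simp: u_def b_def)
  ultimately show
    "S \<in> {approval_voting X N u b | u b. u \<in> profiles X N \<and> b \<in> index_vectors X N}"
    by blast
qed

end
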